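(* Let $\mathcal{S}\subset\mathbb{Z}\times\mathbb{Z}$ be a finite set with nonzero weights $(w_s)_{s\in\mathcal{S}}$ in $\mathbb{C}$, and assume that the Laurent polynomial $S(X,Y)=\sum_{s\in\mathcal{S}}w_sX^{s_x}Y^{s_y}$ is not univariate. Let $\mathcal{O}$ be the orbit of the walk, let $k=\mathbb{C}(S(x,y))$, and let $k(\mathcal{O})$ be the subfield of $\mathbb{K}=\overline{\mathbb{C}(x,y)}$ generated over $k$ by the coordinates of all pairs in $\mathcal{O}$. Then the field extensions $k(\mathcal{O})\,|\,k(x)$ and $k(\mathcal{O})\,|\,k(y)$ are Galois.
   Context: Here $x,y$ are two indeterminates and $\mathbb{K}=\overline{\mathbb{C}(x,y)}$ is an algebraic closure of $\mathbb{C}(x,y)$. "Not univariate" means that both variables $X$ and $Y$ actually occur in $S(X,Y)$. Two pairs $(u,v),(u',v')\in\mathbb{K}\times\mathbb{K}$ are $x$-adjacent, written $(u,v)\sim^x(u',v')$, if $u=u'$ and $S(u,v)=S(u',v')$; they are $y$-adjacent, written $(u,v)\sim^y(u',v')$, if $v=v'$ and $S(u,v)=S(u',v')$. They are adjacent, written $\sim$, if they are $x$-adjacent or $y$-adjacent, and $\sim^*$ is the transitive closure of $\sim$. The orbit of the walk $\mathcal{O}$ is the set of pairs $(u,v)\in\mathbb{K}\times\mathbb{K}$ with $(u,v)\sim^*(x,y)$ (it may be infinite). An algebraic extension $M|L$ (possibly of infinite degree) is Galois if $L$ is exactly the subfield of $M$ of elements fixed by every $L$-algebra automorphism of $M$.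 *)

theory Defs
  imports "HOL-Algebra.Algebraic_Closure_Type" "HOL-Algebra.Generated_Fields"
begin

section \<open>Galois extensions of possibly infinite degree\<close>

text \<open>All fields live inside an ambient ring \<open>R\<close>. An extension \<open>M|L\<close> is given by two subfields
  of \<open>R\<close>; the arguments are in this order.\<close>

context ring
begin

definition algebraic_extension :: "'a set \<Rightarrow> 'a set \<Rightarrow> bool" where
  "algebraic_extension M L \<longleftrightarrow>
     subfield M R \<and> subfield L R \<and> L \<subseteq> M \<and> (\<forall>a\<in>M. (algebraic over L) a)"

text \<open>Only the values on \<open>M\<close> of an automorphism matter; outside \<open>M\<close> the functions are arbitrary.\<close>

definition field_auts :: "'a set \<Rightarrow> 'a set \<Rightarrow> ('a \<Rightarrow> 'a) set" where
  "field_auts M L =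
     {\<sigma> \<in> ring_iso (R\<lparr>carrier := M\<rparr>) (R\<lparr>carrier := M\<rparr>). \<forall>a\<in>L. \<sigma> a = a}"

definition galois_extension :: "'a set \<Rightarrow> 'a set \<Rightarrow> bool" where
  "galois_extension M L \<longleftrightarrow>
     algebraic_extension M L \<and> {a \<in> M. \<forall>\<sigma>\<in>field_auts M L. \<sigma> a = a} = L"

end


section \<open>The algebraic closure of the field of bivariate rational functions\<close>

text \<open>\<open>\<complex>(x,y)\<close> is the fraction field of \<open>\<complex>[x][y]\<close>: the inner polynomial variable is \<open>x\<close>,
  the outer one is \<open>y\<close>.\<close>

type_synonym ratfun_closure = "complex poly poly fract alg_closure"

abbreviation \<KK> :: "ratfun_closure ring" where
  "\<KK> \<equiv> ring_of_type_algebra"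

definition cst :: "complex \<Rightarrow> ratfun_closure" where
  "cst c = to_ac (to_fract [:[:c:]:])"

definition x_var :: ratfun_closure where
  "x_var = to_ac (to_fract [:[:0, 1:]:])"

definition y_var :: ratfun_closure where
  "y_var = to_ac (to_fract [:0, 1:])"

definition adjoin :: "ratfun_closure set \<Rightarrow> ratfun_closure set \<Rightarrow> ratfun_closure set" where
  "adjoin k A = generate_field \<KK> (k \<union> A)"


section \<open>The weighted step polynomial and the orbit of the walk\<close>

text \<open>A Laurent polynomial is given by its support \<open>\<S>\<close> and its coefficients \<open>w\<close>, which are assumed
  to be nonzero on \<open>\<S>\<close>; the values of \<open>w\<close> outside \<open>\<S>\<close> play no role.\<close>

definition not_univariate :: "(int \<times> int) set \<Rightarrow> bool" where
  "not_univariate \<S> \<longleftrightarrow> (\<exists>s\<in>\<S>. fst s \<noteq> 0) \<and> (\<exists>s\<in>\<S>. snd s \<noteq> 0)"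

definition step_poly ::
  "(int \<times> int) set \<Rightarrow> (int \<times> int \<Rightarrow> complex) \<Rightarrow> ratfun_closure \<times> ratfun_closure \<Rightarrow> ratfun_closure" where
  "step_poly \<S> w = (\<lambda>(u, v). \<Sum>s\<in>\<S>. cst (w s) * u powi fst s * v powi snd s)"

text \<open>Since \<open>0 powi n = 0\<close> for negative \<open>n\<close>, an equation between values of the Laurent polynomial
  is only meaningful at pairs where no negative power of \<open>0\<close> is taken.\<close>

definition defined_at :: "(int \<times> int) set \<Rightarrow> ratfun_closure \<times> ratfun_closure \<Rightarrow> bool" where
  "defined_at \<S> = (\<lambda>(u, v). \<forall>s\<in>\<S>. (fst s < 0 \<longrightarrow> u \<noteq> 0) \<and> (snd s < 0 \<longrightarrow> v \<noteq> 0))"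

definition same_value ::
  "(int \<times> int) set \<Rightarrow> (int \<times> int \<Rightarrow> complex) \<Rightarrow>
   ratfun_closure \<times> ratfun_closure \<Rightarrow> ratfun_closure \<times> ratfun_closure \<Rightarrow> bool" where
  "same_value \<S> w p q \<longleftrightarrow>
     defined_at \<S> p \<and> defined_at \<S> q \<and> step_poly \<S> w p = step_poly \<S> w q"

definition x_adjacent ::
  "(int \<times> int) set \<Rightarrow> (int \<times> int \<Rightarrow> complex) \<Rightarrow>
   ratfun_closure \<times> ratfun_closure \<Rightarrow> ratfun_closure \<times> ratfun_closure \<Rightarrow> bool" where
  "x_adjacent \<S> w p q \<longleftrightarrow> fst p = fst q \<and> same_value \<S> w p q"

definition y_adjacent ::
  "(int \<times> int) set \<Rightarrow> (int \<times> int \<Rightarrow> complex) \<Rightarrow>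
   ratfun_closure \<times> ratfun_closure \<Rightarrow> ratfun_closure \<times> ratfun_closure \<Rightarrow> bool" where
  "y_adjacent \<S> w p q \<longleftrightarrow> snd p = snd q \<and> same_value \<S> w p q"

definition adjacent ::
  "(int \<times> int) set \<Rightarrow> (int \<times> int \<Rightarrow> complex) \<Rightarrow>
   ratfun_closure \<times> ratfun_closure \<Rightarrow> ratfun_closure \<times> ratfun_closure \<Rightarrow> bool" where
  "adjacent \<S> w p q \<longleftrightarrow> x_adjacent \<S> w p q \<or> y_adjacent \<S> w p q"

definition walk_orbit ::
  "(int \<times> int) set \<Rightarrow> (int \<times> int \<Rightarrow> complex) \<Rightarrow> (ratfun_closure \<times> ratfun_closure) set" where
  "walk_orbit \<S> w = {p. tranclp (adjacent \<S> w) p (x_var, y_var)}"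

definition base_field :: "(int \<times> int) set \<Rightarrow> (int \<times> int \<Rightarrow> complex) \<Rightarrow> ratfun_closure set" where
  "base_field \<S> w = adjoin (range cst) {step_poly \<S> w (x_var, y_var)}"

definition orbit_field :: "(int \<times> int) set \<Rightarrow> (int \<times> int \<Rightarrow> complex) \<Rightarrow> ratfun_closure set" where
  "orbit_field \<S> w =
     adjoin (base_field \<S> w) (fst ` walk_orbit \<S> w \<union> snd ` walk_orbit \<S> w)"

end

(* Every element of k(\<O>) is algebraic over L = k(x): on the orbit S takes the constant value
   t = S(x,y), which is not in \<complex>, so S(u,Y) - t is a nonzero polynomial and each coordinate
   of a pair is algebraic over \<complex>(t) together with the other one. For a in k(\<O>) outside L
   there is, in characteristic zero, an L-embedding of k(\<O>) into \<KK> which moves a (Zorn).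
   Any such embedding fixes x and t and preserves adjacency; since (x, y) and (x, \<sigma> y) are
   x-adjacent, it maps the orbit into itself, hence k(\<O>) into k(\<O>), and it is onto because
   it permutes the finitely many roots in k(\<O>) of each polynomial over L. *)

theory Submission
  imports Defs
begin

section \<open>Extending field homomorphisms to algebraic elements\<close>

text \<open>The orbit may be infinite, so neither degrees nor the splitting field of a single
  polynomial are available for k(O) over L. The argument therefore separates algebra from
  combinatorics: \<open>galois_extension_if_stable\<close> knows nothing of walks and asks, besides
  algebraicity, only that L-embeddings of k(O) into \<open>\<KK>\<close> send k(O) into itself. This
  stability plays the part of normality; separability is hidden in \<open>other_root\<close>, where
  characteristic zero enters. Algebraicity avoids towers of extensions along paths of the orbit. The
  field of all elements algebraic over L is formed once; it contains every root of a nonzero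
  polynomial over itself, so each edge of the orbit only requires that one coordinate in this field
  forces the other into it. A recurrent obstacle is the convention that negative powers of 0 are 0:
  clearing denominators is valid only at nonzero arguments, and homomorphisms must be seen to
  preserve definedness along with the values of S.\<close>

text \<open>A homomorphism from a subfield of \<open>'a\<close> to \<open>'b\<close> is represented by its graph, so that
  extension of homomorphisms is inclusion and unions of chains need no gluing.\<close>

locale partial_field_hom =
  fixes G :: "('a::field \<times> 'b::field) set"
  assumes one: "(1, 1) \<in> G"
    and add: "(a, b) \<in> G \<Longrightarrow> (c, d) \<in> G \<Longrightarrow> (a + c, b + d) \<in> G"
    and mult: "(a, b) \<in> G \<Longrightarrow> (c, d) \<in> G \<Longrightarrow> (a * c, b * d) \<in> G"
    and uminus: "(a, b) \<in> G \<Longrightarrow> (- a, - b) \<in> G"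
    and inverse: "(a, b) \<in> G \<Longrightarrow> (inverse a, inverse b) \<in> G"
    and zero_right: "(0, b) \<in> G \<Longrightarrow> b = 0"
begin

lemma zero: "(0, 0) \<in> G"
  using add[OF one uminus[OF one]] by simp

lemma diff: "(a, b) \<in> G \<Longrightarrow> (c, d) \<in> G \<Longrightarrow> (a - c, b - d) \<in> G"
  using add[OF _ uminus] by fastforce

lemma divide: "(a, b) \<in> G \<Longrightarrow> (c, d) \<in> G \<Longrightarrow> (a / c, b / d) \<in> G"
  using mult[OF _ inverse] by (fastforce simp: field_class.field_divide_inverse)

lemma power: "(a, b) \<in> G \<Longrightarrow> (a ^ n, b ^ n) \<in> G"
  by (induction n) (auto intro: one mult)

lemma power_int: "(a, b) \<in> G \<Longrightarrow> (a powi n, b powi n) \<in> G"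
  by (auto simp: power_int_def intro: power inverse)

lemma sum: "(\<And>i. i \<in> I \<Longrightarrow> (f i, g i) \<in> G) \<Longrightarrow> (sum f I, sum g I) \<in> G"
  by (induction I rule: infinite_finite_induct) (auto intro: zero add)

lemma unique: "(a, b) \<in> G \<Longrightarrow> (a, c) \<in> G \<Longrightarrow> b = c"
  using zero_right[of "b - c"] diff[of a b a c] by simp

text \<open>If \<open>a\<close> were nonzero, multiplying \<open>(a, 0)\<close> by the pair of
  inverses would put \<open>(1, 0)\<close> into \<open>G\<close>, against \<open>unique\<close> at
  1. Injectivity thus follows from closure under inverses.\<close>

lemma zero_left: "(a, 0) \<in> G \<Longrightarrow> a = 0"
  using mult[of a 0 "inverse a" "inverse 0"] inverse[of a 0] unique[OF one, of 0] by (cases "a = 0") auto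

lemma zero_iff: "(a, b) \<in> G \<Longrightarrow> a = 0 \<longleftrightarrow> b = 0"
  using zero_left zero_right by blast

lemma injective: "(a, b) \<in> G \<Longrightarrow> (c, b) \<in> G \<Longrightarrow> a = c"
  using zero_left[of "a - c"] diff[of a b c b] by simp

section \<open>Polynomials corresponding under a partial homomorphism\<close>

text \<open>This is coefficientwise application of the homomorphism, kept as a relation because the
  homomorphism itself is only a graph.\<close>

definition poly_rel :: "'a poly \<Rightarrow> 'b poly \<Rightarrow> bool" where
  "poly_rel p q \<longleftrightarrow> (\<forall>i. (coeff p i, coeff q i) \<in> G)"

lemma poly_rel_0: "poly_rel 0 0"
  by (simp add: poly_rel_def zero)

lemma poly_rel_add: "poly_rel p q \<Longrightarrow> poly_rel p' q' \<Longrightarrow> poly_rel (p + p') (q + q')"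
  by (simp add: poly_rel_def add)

lemma poly_rel_diff: "poly_rel p q \<Longrightarrow> poly_rel p' q' \<Longrightarrow> poly_rel (p - p') (q - q')"
  by (simp add: poly_rel_def diff)

lemma poly_rel_uminus: "poly_rel p q \<Longrightarrow> poly_rel (- p) (- q)"
  by (simp add: poly_rel_def uminus)

lemma poly_rel_mult: "poly_rel p q \<Longrightarrow> poly_rel p' q' \<Longrightarrow> poly_rel (p * p') (q * q')"
  by (simp add: poly_rel_def coeff_mult sum mult)

lemma poly_rel_monom: "(a, b) \<in> G \<Longrightarrow> poly_rel (monom a n) (monom b n)"
  by (simp add: poly_rel_def zero)

lemma poly_rel_const: "(a, b) \<in> G \<Longrightarrow> poly_rel [:a:] [:b:]"
  by (simp add: poly_rel_def coeff_pCons zero split: nat.split)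

lemma poly_rel_eq_0_iff: "poly_rel p q \<Longrightarrow> p = 0 \<longleftrightarrow> q = 0"
  by (metis poly_rel_def poly_eqI coeff_0 zero_left zero_right)

lemma poly_rel_degree: assumes "poly_rel p q" shows "Polynomial.degree p = Polynomial.degree q"
proof -
  have "coeff p i = 0 \<longleftrightarrow> coeff q i = 0" for i
    using assms zero_left zero_right unfolding poly_rel_def by metis
  thus ?thesis
    by (simp add: Polynomial.degree_def)
qed

lemma poly_rel_eval:
  assumes "poly_rel p q" "(a, b) \<in> G"
  shows "(poly p a, poly q b) \<in> G"
  unfolding poly_altdef poly_rel_degree[OF assms(1)]
  by (intro sum mult power assms(2)) (use assms(1) in \<open>simp add: poly_rel_def\<close>)

text \<open>Long division is carried out on both sides at once: each term of the quotient is formed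
  from related coefficients, so quotients and remainders stay related.\<close>

lemma poly_rel_division:
  assumes "poly_rel g g'" "g \<noteq> 0" "poly_rel p q"
  shows "\<exists>h h' r r'. poly_rel h h' \<and> poly_rel r r' \<and> p = g * h + r \<and> q = g' * h' + r' \<and>
           (r = 0 \<or> Polynomial.degree r < Polynomial.degree g)"
  using assms(3)
\<comment> \<open>The zero polynomial gets measure 0 and a nonzero constant gets 1, so that
  cancelling a constant counts as progress.\<close>
proof (induction "if p = 0 then 0 else Suc (Polynomial.degree p)" arbitrary: p q rule: less_induct)
  case less
  show ?case
  proof (cases "p = 0 \<or> Polynomial.degree p < Polynomial.degree g")
    case True
    thus ?thesis
      using less.prems poly_rel_0 by (intro exI[of _ 0] exI[of _ p] exI[of _ q]) simp
  next
    case False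
    define n where "n = Polynomial.degree p"
    define m where "m = Polynomial.degree g"
    have deg: "Polynomial.degree q = n" "Polynomial.degree g' = m"
      using poly_rel_degree less.prems assms(1) by (auto simp: n_def m_def)
    define s where "s = monom (coeff p n / coeff g m) (n - m)"
    define s' where "s' = monom (coeff q n / coeff g' m) (n - m)"
    have s: "poly_rel s s'"
      using less.prems assms(1) unfolding s_def s'_def
      by (intro poly_rel_monom divide) (auto simp: poly_rel_def)
    have "m \<le> n" "coeff g m \<noteq> 0"
      using False assms(2) by (auto simp: n_def m_def)
    define p1 where "p1 = p - g * s"
    have "Polynomial.degree (g * s) \<le> n"
      using degree_mult_le[of g s] degree_monom_le[of "coeff p n / coeff g m" "n - m"] \<open>m \<le> n\<close>
      by (simp add: s_def m_def)
    hence "Polynomial.degree p1 \<le> n"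
      by (simp add: p1_def n_def degree_diff_le)
    moreover have "coeff p1 n = 0"
      using \<open>m \<le> n\<close> \<open>coeff g m \<noteq> 0\<close> coeff_monom_mult[of "coeff p n / coeff g m" "n - m" g n]
      by (simp add: p1_def s_def mult.commute)
    ultimately have "p1 = 0 \<or> Polynomial.degree p1 < n"
      by (rule eq_zero_or_degree_less)
    hence "(if p1 = 0 then 0 else Suc (Polynomial.degree p1))
             < (if p = 0 then 0 else Suc (Polynomial.degree p))"
      using False by (auto simp: n_def)
    from less.hyps[OF this, of "q - g' * s'"] obtain h h' r r' where
      *: "poly_rel h h'" "poly_rel r r'" "p1 = g * h + r" "q - g' * s' = g' * h' + r'"
      "r = 0 \<or> Polynomial.degree r < Polynomial.degree g"
      unfolding p1_def using poly_rel_diff poly_rel_mult less.prems s assms(1) by metis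
    show ?thesis
      using * poly_rel_add[OF s *(1)]
      by (intro exI[of _ "s + h"] exI[of _ "s' + h'"] exI[of _ r] exI[of _ r'])
        (auto simp: p1_def algebra_simps)
  qed
qed

text \<open>The candidate extension of \<open>G\<close> to the ring generated by \<open>a\<close>,
  with \<open>a\<close> sent to \<open>b\<close>. Single-valuedness and closure under inverses
  depend on the choice of \<open>b\<close>.\<close>

definition adjoin_root :: "'a \<Rightarrow> 'b \<Rightarrow> ('a \<times> 'b) set" where
  "adjoin_root a b = {(poly p a, poly q b) | p q. poly_rel p q}"

lemma subset_adjoin_root: "G \<subseteq> adjoin_root a b"
proof
  fix z assume "z \<in> G"
  hence "poly_rel [:fst z:] [:snd z:]"
    by (intro poly_rel_const) simp
  thus "z \<in> adjoin_root a b"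
    unfolding adjoin_root_def
    by (intro CollectI exI[of _ "[:fst z:]"] exI[of _ "[:snd z:]"]) simp
qed

lemma mem_adjoin_root: "(a, b) \<in> adjoin_root a b"
proof -
  have "poly_rel [:0, 1:] [:0, 1:]"
    by (auto simp: poly_rel_def coeff_pCons zero one split: nat.split)
  thus ?thesis
    unfolding adjoin_root_def by (intro CollectI exI[of _ "[:0, 1:]"]) simp
qed

text \<open>Minimality of the degree of \<open>p0\<close> replaces irreducibility. Division by
  \<open>p0\<close> shows that a polynomial vanishing at \<open>a\<close> is a multiple of
  \<open>p0\<close>, hence its partner vanishes at \<open>b\<close>; this makes the relation well
  defined.\<close>

lemma partial_field_hom_adjoin_root:
  assumes rel: "poly_rel p0 q0" and "p0 \<noteq> 0" and "poly p0 a = 0" and "poly q0 b = 0"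
    and minimal: "\<And>p q. poly_rel p q \<Longrightarrow> p \<noteq> 0 \<Longrightarrow> poly p a = 0 \<Longrightarrow>
                    Polynomial.degree p0 \<le> Polynomial.degree p"
  shows "partial_field_hom (adjoin_root a b)"
proof -
  have root: "poly q b = 0" if pq: "poly_rel p q" "poly p a = 0" for p q
  proof -
    obtain h h' r r' where *: "poly_rel h h'" "poly_rel r r'" "p = p0 * h + r" "q = q0 * h' + r'"
      "r = 0 \<or> Polynomial.degree r < Polynomial.degree p0"
      using poly_rel_division[OF rel \<open>p0 \<noteq> 0\<close> pq(1)] by blast
    have "poly r a = 0"
      using pq(2) \<open>poly p0 a = 0\<close> *(3) by simp
    hence "r = 0"
      using minimal[OF *(2)] *(5) by force
    hence "r' = 0"
      using poly_rel_eq_0_iff[OF *(2)] by simp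
    thus ?thesis
      using *(4) \<open>poly q0 b = 0\<close> by simp
  qed
  \<comment> \<open>A Euclidean descent: for p0 = p h + r, evaluation at \<open>a\<close> gives r(a)
    = - p(a) h(a), so an inverse of r(a) yields one of p(a).\<close>
  have inv_small: "\<exists>s s'. poly_rel s s' \<and> poly p a * poly s a = 1"
    if "poly_rel p q" "p \<noteq> 0" "Polynomial.degree p < Polynomial.degree p0" for p q
    using that
  proof (induction "Polynomial.degree p" arbitrary: p q rule: less_induct)
    case less
    have pa: "poly p a \<noteq> 0"
      using minimal[OF less.prems(1,2)] less.prems(3) by force
    show ?case
    proof (cases "Polynomial.degree p = 0")
      case True
      then obtain c where c: "p = [:c:]"
        by (rule degree_eq_zeroE)
      have "(c, coeff q 0) \<in> G"
        using less.prems(1) unfolding poly_rel_def c by (metis coeff_pCons_0)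
      hence "poly_rel [:inverse c:] [:inverse (coeff q 0):]"
        by (intro poly_rel_const inverse)
      thus ?thesis
        using c less.prems(2) by (intro exI[of _ "[:inverse c:]"]) auto
    next
      case False
      obtain h h' r r' where *: "poly_rel h h'" "poly_rel r r'" "p0 = p * h + r" "q0 = q * h' + r'"
        "r = 0 \<or> Polynomial.degree r < Polynomial.degree p"
        using poly_rel_division[OF less.prems(1,2) rel] by blast
      \<comment> \<open>Otherwise \<open>h\<close> would vanish at \<open>a\<close>, although its
        degree is below that of \<open>p0\<close> because \<open>p\<close> is not constant.\<close>
      have "r \<noteq> 0"
      proof
        assume "r = 0"
        hence "poly h a = 0" "h \<noteq> 0"
          using *(3) pa \<open>poly p0 a = 0\<close> \<open>p0 \<noteq> 0\<close> by auto
        hence "Polynomial.degree p0 \<le> Polynomial.degree h"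
          using minimal[OF *(1)] by simp
        moreover have "Polynomial.degree p0 = Polynomial.degree p + Polynomial.degree h"
          using *(3) \<open>r = 0\<close> \<open>h \<noteq> 0\<close> less.prems(2) by (simp add: degree_mult_eq)
        ultimately show False
          using False by simp
      qed
      hence "Polynomial.degree r < Polynomial.degree p"
        using *(5) by simp
      then obtain s s' where s: "poly_rel s s'" "poly r a * poly s a = 1"
        using less.hyps[OF _ *(2) \<open>r \<noteq> 0\<close>] less.prems(3) by auto
      have "poly r a = - poly p a * poly h a"
        using *(3) \<open>poly p0 a = 0\<close> by (simp add: add_eq_0_iff)
      thus ?thesis
        using s poly_rel_uminus[OF poly_rel_mult[OF *(1) s(1)]]
        by (intro exI[of _ "- (h * s)"] exI[of _ "- (h' * s')"]) (simp add: algebra_simps)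
    qed
  qed
  have inv: "\<exists>s s'. poly_rel s s' \<and> poly p a * poly s a = 1"
    if pq: "poly_rel p q" "poly p a \<noteq> 0" for p q
  proof -
    obtain h h' r r' where *: "poly_rel h h'" "poly_rel r r'" "p = p0 * h + r" "q = q0 * h' + r'"
      "r = 0 \<or> Polynomial.degree r < Polynomial.degree p0"
      using poly_rel_division[OF rel \<open>p0 \<noteq> 0\<close> pq(1)] by blast
    have "poly r a = poly p a"
      using \<open>poly p0 a = 0\<close> *(3) by simp
    thus ?thesis
      using inv_small[OF *(2)] *(5) pq(2) by fastforce
  qed
  show ?thesis
  proof
    fix x y x' y' assume "(x, y) \<in> adjoin_root a b" "(x', y') \<in> adjoin_root a b"
    then obtain p q p' q' where *: "poly_rel p q" "x = poly p a" "y = poly q b"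
      "poly_rel p' q'" "x' = poly p' a" "y' = poly q' b"
      unfolding adjoin_root_def by blast
    show "(x + x', y + y') \<in> adjoin_root a b"
      unfolding adjoin_root_def using * poly_rel_add[OF *(1,4)]
      by (intro CollectI exI[of _ "p + p'"] exI[of _ "q + q'"]) simp
    show "(x * x', y * y') \<in> adjoin_root a b"
      unfolding adjoin_root_def using * poly_rel_mult[OF *(1,4)]
      by (intro CollectI exI[of _ "p * p'"] exI[of _ "q * q'"]) simp
  next
    fix x y assume "(x, y) \<in> adjoin_root a b"
    then obtain p q where *: "poly_rel p q" "x = poly p a" "y = poly q b"
      unfolding adjoin_root_def by blast
    show "(- x, - y) \<in> adjoin_root a b"
      unfolding adjoin_root_def using * poly_rel_uminus[OF *(1)]
      by (intro CollectI exI[of _ "- p"] exI[of _ "- q"]) simp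
    show "(inverse x, inverse y) \<in> adjoin_root a b"
    proof (cases "poly p a = 0")
      case True
      hence "x = 0" "y = 0"
        using root[OF *(1)] * by auto
      thus ?thesis
        using subset_adjoin_root zero by auto
    next
      case False
      obtain s s' where s: "poly_rel s s'" "poly p a * poly s a = 1"
        using inv[OF *(1) False] by blast
      \<comment> \<open>The inverse was found at \<open>a\<close> only; it carries over to
        \<open>b\<close> because \<open>p * s - 1\<close> vanishes at \<open>a\<close>.\<close>
      have "poly (q * s' - 1) b = 0"
        using s poly_rel_diff[OF poly_rel_mult[OF *(1) s(1)] poly_rel_const[OF one]]
        by (intro root[of "p * s - 1"]) (simp_all add: one_pCons)
      hence "inverse x = poly s a" "inverse y = poly s' b"
        using s(2) * by (auto simp: inverse_unique)
      thus ?thesis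
        unfolding adjoin_root_def using s(1) by blast
    qed
  next
    show "(1, 1) \<in> adjoin_root a b"
      using subset_adjoin_root one by auto
  next
    fix y assume "(0, y) \<in> adjoin_root a b"
    thus "y = 0"
      unfolding adjoin_root_def using root by force
  qed
qed

end

section \<open>Algebraic elements and maximal extensions\<close>

text \<open>Phrased with type-class polynomials so as to fit \<open>poly_rel\<close>;
  \<open>algebraic_elem_iff\<close> connects it with the list polynomials behind
  \<open>algebraic over\<close>.\<close>

definition algebraic_elem :: "'a::field set \<Rightarrow> 'a \<Rightarrow> bool" where
  "algebraic_elem F a \<longleftrightarrow> (\<exists>p. p \<noteq> 0 \<and> (\<forall>i. coeff p i \<in> F) \<and> poly p a = 0)"

lemma algebraic_elem_mono: "algebraic_elem F a \<Longrightarrow> F \<subseteq> F' \<Longrightarrow> algebraic_elem F' a"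
  unfolding algebraic_elem_def by blast

context partial_field_hom
begin

lemma obtain_minimal_poly_rel:
  assumes "algebraic_elem (Domain G) a"
  obtains p q where "poly_rel p q" "p \<noteq> 0" "poly p a = 0"
    "\<And>p' q'. poly_rel p' q' \<Longrightarrow> p' \<noteq> 0 \<Longrightarrow> poly p' a = 0 \<Longrightarrow>
       Polynomial.degree p \<le> Polynomial.degree p'"
proof -
  define P where "P = (\<lambda>p. p \<noteq> 0 \<and> poly p a = 0 \<and> (\<exists>q. poly_rel p q))"
  obtain p where p: "p \<noteq> 0" "\<forall>i. coeff p i \<in> Domain G" "poly p a = 0"
    using assms unfolding algebraic_elem_def by blast
  obtain f where f: "(coeff p i, f i) \<in> G" for i
    using p(2) unfolding Domain_iff by metis
  \<comment> \<open>The chosen images of the vanishing coefficients are 0, so \<open>f\<close> is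
    the coefficient sequence of a polynomial.\<close>
  have "f i = 0" if "i > Polynomial.degree p" for i
    using f[of i] zero_right that by (simp add: coeff_eq_0)
  hence "eventually (\<lambda>i. f i = 0) cofinite"
    by (intro MOST_nat[THEN iffD2] exI[of _ "Polynomial.degree p"]) auto
  hence "poly_rel p (Abs_poly f)"
    using f by (simp add: poly_rel_def Abs_poly_inverse)
  hence "P p"
    using p by (auto simp: P_def)
  then obtain m where "P m" "\<And>p'. P p' \<Longrightarrow> Polynomial.degree m \<le> Polynomial.degree p'"
    using ex_has_least_nat[of P p Polynomial.degree] by blast
  thus ?thesis
    using that unfolding P_def by blast
qed

end

text \<open>Take a Zorn-maximal extension. An algebraic element can be adjoined by sending it to a
  root of the partner of its minimal polynomial, which exists since the target is algebraically
  closed; by maximality the element was already in the domain.\<close>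

lemma extend_to_algebraic_elems:
  fixes G :: "('a::field \<times> 'b::alg_closed_field) set"
  assumes "partial_field_hom G"
  obtains H where "G \<subseteq> H" "partial_field_hom H"
    "\<And>a. algebraic_elem (Domain G) a \<Longrightarrow> a \<in> Domain H"
proof -
  define \<A> where "\<A> = {H. G \<subseteq> H \<and> partial_field_hom H}"
  have "\<exists>H\<in>\<A>. \<forall>H'\<in>\<A>. H \<subseteq> H' \<longrightarrow> H' = H"
  proof (rule subset_Zorn_nonempty)
    show "\<A> \<noteq> {}"
      using assms by (auto simp: \<A>_def)
    fix \<C> assume "\<C> \<noteq> {}" and ch: "subset.chain \<A> \<C>"
    have hom: "partial_field_hom K" if "K \<in> \<C>" for K
      using ch that by (auto simp: subset_chain_def \<A>_def)
    have common: "\<exists>K\<in>\<C>. z \<in> K \<and> z' \<in> K" if "z \<in> \<Union>\<C>" "z' \<in> \<Union>\<C>" for z z'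
      using that ch unfolding subset_chain_def by blast
    have "partial_field_hom (\<Union>\<C>)"
    proof
      fix a b c d assume "(a, b) \<in> \<Union>\<C>" "(c, d) \<in> \<Union>\<C>"
      then obtain K where K: "K \<in> \<C>" "(a, b) \<in> K" "(c, d) \<in> K"
        using common by blast
      interpret K: partial_field_hom K
        by (rule hom[OF K(1)])
      show "(a + c, b + d) \<in> \<Union>\<C>" "(a * c, b * d) \<in> \<Union>\<C>"
        using K K.add K.mult by blast+
    next
      fix a b assume "(a, b) \<in> \<Union>\<C>"
      then obtain K where K: "K \<in> \<C>" "(a, b) \<in> K"
        by blast
      interpret K: partial_field_hom K
        by (rule hom[OF K(1)])
      show "(- a, - b) \<in> \<Union>\<C>" "(inverse a, inverse b) \<in> \<Union>\<C>"
        using K K.uminus K.inverse by blast+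
    next
      show "(1, 1) \<in> \<Union>\<C>"
        using \<open>\<C> \<noteq> {}\<close> hom partial_field_hom.one by blast
    next
      show "b = 0" if "(0, b) \<in> \<Union>\<C>" for b
        using that hom partial_field_hom.zero_right by blast
    qed
    moreover have "G \<subseteq> \<Union>\<C>"
      using \<open>\<C> \<noteq> {}\<close> ch unfolding subset_chain_def \<A>_def by blast
    ultimately show "\<Union>\<C> \<in> \<A>"
      by (simp add: \<A>_def)
  qed
  then obtain H where H: "G \<subseteq> H" "partial_field_hom H"
    and max: "\<And>K. H \<subseteq> K \<Longrightarrow> partial_field_hom K \<Longrightarrow> K = H"
    unfolding \<A>_def by (metis (mono_tags, lifting) mem_Collect_eq order_trans)
  interpret H: partial_field_hom H
    by (rule H(2))
  have "a \<in> Domain H" if "algebraic_elem (Domain G) a" for a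
  proof -
    have "algebraic_elem (Domain H) a"
      using that H(1) by (rule algebraic_elem_mono[OF _ Domain_mono])
    then obtain p q where *: "H.poly_rel p q" "p \<noteq> 0" "poly p a = 0"
      "\<And>p' q'. H.poly_rel p' q' \<Longrightarrow> p' \<noteq> 0 \<Longrightarrow> poly p' a = 0 \<Longrightarrow>
         Polynomial.degree p \<le> Polynomial.degree p'"
      by (rule H.obtain_minimal_poly_rel) blast
    have "Polynomial.degree p > 0"
      using *(2,3) by (cases "Polynomial.degree p = 0") (auto elim: degree_eq_zeroE)
    hence "Polynomial.degree q > 0"
      using H.poly_rel_degree[OF *(1)] by simp
    then obtain b where b: "poly q b = 0"
      using alg_closed_imp_poly_has_root by blast
    have "partial_field_hom (H.adjoin_root a b)"
      by (rule H.partial_field_hom_adjoin_root[OF *(1-3) b *(4)])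
    hence "H.adjoin_root a b = H"
      by (rule max[OF H.subset_adjoin_root])
    thus ?thesis
      using H.mem_adjoin_root[of a b] by blast
  qed
  thus ?thesis
    using that H by blast
qed

text \<open>In characteristic zero, \<open>c (X - a)\<^sup>n\<close> has the coefficient \<open>- n c a\<close> of degree \<open>n - 1\<close>;
  so a polynomial whose only root is \<open>a\<close> can have all its coefficients in a field
  only if \<open>a\<close> lies in that field.\<close>

lemma other_root:
  fixes p :: "'a::{alg_closed_field, field_char_0} poly"
  assumes "p \<noteq> 0" "poly p a = 0"
    and closed: "\<And>c d. c \<in> F \<Longrightarrow> d \<in> F \<Longrightarrow> c / d \<in> F" "\<And>c d. c \<in> F \<Longrightarrow> d \<in> F \<Longrightarrow> c * d \<in> F"
      "\<And>c. c \<in> F \<Longrightarrow> - c \<in> F" "\<And>n. of_nat n \<in> F"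
    and coeff: "\<And>i. coeff p i \<in> F" and "a \<notin> F"
  obtains b where "poly p b = 0" "b \<noteq> a"
proof -
  obtain q where q: "p = [:- a, 1:] ^ Polynomial.order a p * q" "\<not> [:- a, 1:] dvd q"
    using order_decomp[OF assms(1)] by blast
  show ?thesis
  proof (cases "Polynomial.degree q = 0")
    case False
    then obtain b where "poly q b = 0"
      using alg_closed_imp_poly_has_root by blast
    moreover from this have "b \<noteq> a"
      using q(2) poly_eq_0_iff_dvd by blast
    ultimately show ?thesis
      using that q(1) by (metis mult_zero_right poly_mult)
  next
    case True
    then obtain c where c: "q = [:c:]"
      by (rule degree_eq_zeroE)
    define n where "n = Polynomial.order a p"
    have n: "n > 0"
      using assms(1,2) order_root[of p a] by (simp add: n_def)
    have p: "p = smult c ([:- a, 1:] ^ n)"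
      using q(1) c by (simp add: n_def)
    have "c \<noteq> 0"
      using p assms(1) by auto
    have "coeff p n = c" "coeff p (n - 1) = - of_nat n * c * a"
      using n binomial_symmetric[of 1 n] by (simp_all add: p coeff_linear_poly_power)
    \<comment> \<open>Characteristic zero is what permits the division by
      \<open>of_nat n\<close>.\<close>
    hence "a = - (coeff p (n - 1) / (of_nat n * coeff p n))"
      using n \<open>c \<noteq> 0\<close> by (simp add: field_simps)
    moreover have "- (coeff p (n - 1) / (of_nat n * coeff p n)) \<in> F"
      by (intro closed coeff)
    ultimately show ?thesis
      using \<open>a \<notin> F\<close> by simp
  qed
qed

section \<open>Algebraic and Galois extensions inside a field type\<close>

text \<open>The finitely many coefficients of a polynomial for \<open>x\<close> generate a finite
  extension \<open>F\<close> of \<open>K\<close>; adjoining \<open>x\<close> to \<open>F\<close>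
  remains finite over \<open>K\<close>.\<close>

lemma (in field) algebraic_trans:
  assumes "subfield K R" "subring E R" "\<And>e. e \<in> E \<Longrightarrow> (algebraic over K) e"
    and "x \<in> carrier R" "(algebraic over E) x"
  shows "(algebraic over K) x"
proof -
  obtain p where p: "p \<in> carrier (E[X])" "p \<noteq> []" "eval p x = \<zero>"
    using algebraicE[OF assms(2,4,5)] by blast
  have pE: "set p \<subseteq> E" "polynomial E p"
    using p(1) by (auto simp: univ_poly_def polynomial_def)
  hence pR: "set p \<subseteq> carrier R"
    using subringE(1)[OF assms(2)] by blast
  define F where "F = finite_extension K p"
  have F: "subfield F R" "finite_dimension K F"
    unfolding F_def
    using finite_extension_is_subfield[OF assms(1) pR]
      finite_extension_finite_dimension(1)[OF assms(1) pR] pE(1) assms(3) by blast+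
  have "p \<in> carrier (F[X])"
    using pE p(2) finite_extension_mem[OF subfieldE(1)[OF assms(1)] pR]
    by (auto simp: univ_poly_def polynomial_def F_def)
  hence "(algebraic over F) x"
    using p(2,3) by (rule algebraicI)
  hence "finite_dimension F (simple_extension F x)"
    using finite_dimension_simple_extension[OF F(1) assms(4)] by simp
  hence "finite_dimension K (simple_extension F x)"
    by (rule telescopic_base_dim(1)[OF assms(1) F(1,2)])
  thus ?thesis
    using finite_dimension_imp_algebraic[OF assms(1)]
      simple_extension_is_subring[OF subfieldE(1)[OF F(1)] assms(4)]
      simple_extension_mem[OF subfieldE(1)[OF F(1)] assms(4)] by blast
qed

section \<open>Type-class fields and their subfields as algebraic structures\<close>

interpretation type_field: domain "ring_of_type_algebra :: 'a::field ring"
  by (rule field.axioms(1)[OF field_from_type_algebra])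

lemma ring_of_type_algebra_simps [simp]:
  "carrier (ring_of_type_algebra :: 'a::field ring) = UNIV"
  "\<zero>\<^bsub>(ring_of_type_algebra :: 'a ring)\<^esub> = 0"
  "\<one>\<^bsub>(ring_of_type_algebra :: 'a ring)\<^esub> = 1"
  "x \<oplus>\<^bsub>(ring_of_type_algebra :: 'a ring)\<^esub> y = x + y"
  "x \<otimes>\<^bsub>(ring_of_type_algebra :: 'a ring)\<^esub> y = x * y"
  by (simp_all add: ring_of_type_algebra_def)

lemma a_inv_type_algebra [simp]: "\<ominus>\<^bsub>ring_of_type_algebra\<^esub> x = - (x::'a::field)"
  by (rule type_field.minus_equality) simp_all

lemma m_inv_type_algebra [simp]:
  "x \<noteq> 0 \<Longrightarrow> inv\<^bsub>ring_of_type_algebra\<^esub> x = inverse (x::'a::field)"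
  by (rule type_field.comm_inv_char) simp_all

lemma nat_pow_type_algebra [simp]:
  "x [^]\<^bsub>(ring_of_type_algebra :: 'a::field ring)\<^esub> (n::nat) = x ^ n"
  by (induction n) simp_all

lemma subfield_from_type_algebraI:
  fixes F :: "'a::field set"
  assumes "1 \<in> F" "\<And>a b. a \<in> F \<Longrightarrow> b \<in> F \<Longrightarrow> a + b \<in> F" "\<And>a b. a \<in> F \<Longrightarrow> b \<in> F \<Longrightarrow> a * b \<in> F"
    "\<And>a. a \<in> F \<Longrightarrow> - a \<in> F" "\<And>a. a \<in> F \<Longrightarrow> inverse a \<in> F"
  shows "subfield F ring_of_type_algebra"
  using assms by (intro field.subfieldI'[OF field_from_type_algebra] type_field.subringI) auto

context
  fixes F :: "'a::field set"
  assumes F: "subfield F ring_of_type_algebra"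
begin

lemma subfield_1: "1 \<in> F" and subfield_0: "0 \<in> F"
  using subringE(2,3)[OF subfieldE(1)[OF F]] by simp_all

lemma subfield_add: "a \<in> F \<Longrightarrow> b \<in> F \<Longrightarrow> a + b \<in> F"
  using subringE(7)[OF subfieldE(1)[OF F]] by simp

lemma subfield_mult: "a \<in> F \<Longrightarrow> b \<in> F \<Longrightarrow> a * b \<in> F"
  using subringE(6)[OF subfieldE(1)[OF F]] by simp

lemma subfield_uminus: "a \<in> F \<Longrightarrow> - a \<in> F"
  using subringE(5)[OF subfieldE(1)[OF F]] by simp

lemma subfield_diff: "a \<in> F \<Longrightarrow> b \<in> F \<Longrightarrow> a - b \<in> F"
  using subfield_add[of a "- b"] subfield_uminus by simp

lemma subfield_inverse: "a \<in> F \<Longrightarrow> inverse a \<in> F"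
  using type_field.subfield_m_inv(1)[OF F, of a] by (cases "a = 0") auto

lemma subfield_divide: "a \<in> F \<Longrightarrow> b \<in> F \<Longrightarrow> a / b \<in> F"
  using subfield_mult[of a "inverse b"] subfield_inverse by (simp add: field_class.field_divide_inverse)

lemma subfield_power: "a \<in> F \<Longrightarrow> a ^ n \<in> F"
  by (induction n) (auto intro: subfield_1 subfield_mult)

lemma subfield_power_int: "a \<in> F \<Longrightarrow> a powi n \<in> F"
  by (auto simp: power_int_def intro: subfield_power subfield_inverse)

lemma subfield_sum: "(\<And>i. i \<in> I \<Longrightarrow> f i \<in> F) \<Longrightarrow> sum f I \<in> F"
  by (induction I rule: infinite_finite_induct) (auto intro: subfield_0 subfield_add)

lemma subfield_of_nat: "of_nat n \<in> F"
  by (induction n) (auto intro: subfield_0 subfield_1 subfield_add)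

end

text \<open>List polynomials start with the leading coefficient, \<open>Poly\<close> with the
  constant one; hence the reversal.\<close>

lemma eval_type_algebra: "type_field.eval xs x = poly (Poly (rev xs)) (x::'a::field)"
  by (induction xs) (simp_all add: Poly_append poly_monom)

lemma algebraic_elem_iff:
  fixes F :: "'a::field set"
  assumes F: "subfield F ring_of_type_algebra"
  shows "(type_field.algebraic over F) a \<longleftrightarrow> algebraic_elem F a"
proof
  assume "(type_field.algebraic over F) a"
  then obtain p where p: "p \<in> carrier (F [X]\<^bsub>ring_of_type_algebra\<^esub>)" "p \<noteq> []"
    "type_field.eval p a = 0"
    using type_field.algebraicE[OF subfieldE(1)[OF F], of a] by auto
  have pF: "set p \<subseteq> F" "hd p \<noteq> 0"
    using p(1,2) by (auto simp: univ_poly_def polynomial_def)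
  define q where "q = Poly (rev p)"
  have "coeff q (length p - 1) = hd p"
    using p(2) by (simp add: q_def nth_default_def rev_nth hd_conv_nth)
  hence "q \<noteq> 0"
    using pF(2) by auto
  moreover have "coeff q i \<in> F" for i
    using pF(1) subfield_0[OF F] by (auto simp: q_def nth_default_def rev_nth)
  ultimately show "algebraic_elem F a"
    using p(3) unfolding algebraic_elem_def q_def eval_type_algebra by blast
next
  assume "algebraic_elem F a"
  then obtain p where p: "p \<noteq> 0" "\<And>i. coeff p i \<in> F" "poly p a = 0"
    unfolding algebraic_elem_def by blast
  show "(type_field.algebraic over F) a"
  proof (rule type_field.algebraicI[of "rev (coeffs p)"])
    show "rev (coeffs p) \<in> carrier (F [X]\<^bsub>ring_of_type_algebra\<^esub>)"
      using p(1,2) by (auto simp: univ_poly_def polynomial_def coeffs_def hd_rev last_map)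
  qed (use p in \<open>simp_all add: eval_type_algebra\<close>)
qed

lemma subfield_algebraic_elems:
  fixes F :: "'a::field set"
  assumes "subfield F ring_of_type_algebra"
  shows "subfield {a. algebraic_elem F a} ring_of_type_algebra"
  using field.subfield_of_algebraics[OF field_from_type_algebra assms] by (simp add: algebraic_elem_iff[OF assms])

lemma algebraic_elem_self:
  fixes F :: "'a::field set"
  assumes "subfield F ring_of_type_algebra" "a \<in> F"
  shows "algebraic_elem F a"
  using type_field.algebraic_self[OF subfieldE(1)[OF assms(1)] assms(2)]
  by (simp add: algebraic_elem_iff[OF assms(1)])

text \<open>Makes the field of elements algebraic over \<open>F\<close> closed under taking roots,
  the property on which the passage from one coordinate to the other rests.\<close>

lemma algebraic_elem_trans:
  fixes F :: "'a::field set"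
  assumes F: "subfield F ring_of_type_algebra" and "algebraic_elem {a. algebraic_elem F a} b"
  shows "algebraic_elem F b"
proof -
  note A = subfield_algebraic_elems[OF F]
  show ?thesis
    using field.algebraic_trans[OF field_from_type_algebra F subfieldE(1)[OF A], of b] assms(2)
    by (simp add: algebraic_elem_iff[OF F] algebraic_elem_iff[OF A])
qed

section \<open>Moving an element and the Galois criterion\<close>

lemma partial_field_hom_Id_on:
  fixes F :: "'a::field set"
  assumes "subfield F ring_of_type_algebra"
  shows "partial_field_hom (Id_on F)"
  by standard (auto intro: assms subfield_1 subfield_add subfield_mult subfield_uminus subfield_inverse)

lemma obtain_hom_moving:
  fixes L :: "'a::{alg_closed_field, field_char_0} set"
  assumes L: "subfield L ring_of_type_algebra" and "algebraic_elem L a" "a \<notin> L"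
  obtains G b where "partial_field_hom G" "Id_on L \<subseteq> G" "(a, b) \<in> G" "b \<noteq> a"
    "\<And>c. algebraic_elem L c \<Longrightarrow> c \<in> Domain G"
proof -
  interpret partial_field_hom "Id_on L"
    by (rule partial_field_hom_Id_on[OF L])
  obtain p q where *: "poly_rel p q" "p \<noteq> 0" "poly p a = 0"
    "\<And>p' q'. poly_rel p' q' \<Longrightarrow> p' \<noteq> 0 \<Longrightarrow> poly p' a = 0 \<Longrightarrow>
       Polynomial.degree p \<le> Polynomial.degree p'"
    using obtain_minimal_poly_rel[of a] assms(2) by auto
  have p: "coeff p i \<in> L" and coeff: "coeff q i = coeff p i" for i
    using *(1)[unfolded poly_rel_def, rule_format, of i] by auto
  \<comment> \<open>The starting homomorphism is the identity on \<open>L\<close>, so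
    \<open>a\<close> may be sent to any root of its own minimal polynomial.\<close>
  have "q = p"
    by (rule poly_eqI) (rule coeff)
  obtain b where b: "poly p b = 0" "b \<noteq> a"
    using other_root[OF *(2,3), of L] p \<open>a \<notin> L\<close>
      subfield_divide[OF L] subfield_mult[OF L] subfield_uminus[OF L] subfield_of_nat[OF L]
    by metis
  have "poly q b = 0"
    using b(1) \<open>q = p\<close> by simp
  hence "partial_field_hom (adjoin_root a b)"
    using *(4) by (rule partial_field_hom_adjoin_root[OF *(1-3)])
  then obtain G where G: "adjoin_root a b \<subseteq> G" "partial_field_hom G"
    "\<And>c. algebraic_elem (Domain (adjoin_root a b)) c \<Longrightarrow> c \<in> Domain G"
    by (rule extend_to_algebraic_elems) blast
  have "L \<subseteq> Domain (adjoin_root a b)"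
    using subset_adjoin_root[of a b] by blast
  hence "c \<in> Domain G" if "algebraic_elem L c" for c
    using G(3) algebraic_elem_mono[OF that] by blast
  thus ?thesis
    using that[OF G(2) _ _ b(2)] G(1) subset_adjoin_root[of a b] mem_adjoin_root[of a b] by blast
qed

text \<open>An element of \<open>M\<close> outside \<open>L\<close> is moved by some homomorphism
  fixing \<open>L\<close>. Stability turns its restriction to \<open>M\<close> into an injective
  endomorphism, and only surjectivity remains to be shown.\<close>

lemma galois_extension_if_stable:
  fixes L M :: "'a::{alg_closed_field, field_char_0} set"
  assumes M: "subfield M ring_of_type_algebra" and L: "subfield L ring_of_type_algebra"
    and "L \<subseteq> M" and alg: "\<And>a. a \<in> M \<Longrightarrow> algebraic_elem L a"
    and stable: "\<And>G a b. partial_field_hom G \<Longrightarrow> Id_on L \<subseteq> G \<Longrightarrow> M \<subseteq> Domain G \<Longrightarrow>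
                   (a, b) \<in> G \<Longrightarrow> a \<in> M \<Longrightarrow> b \<in> M"
  shows "type_field.galois_extension M L"
  unfolding type_field.galois_extension_def
proof
  show "type_field.algebraic_extension M L"
    using assms(1-4) by (simp add: type_field.algebraic_extension_def algebraic_elem_iff)
  have "\<exists>\<sigma>\<in>type_field.field_auts M L. \<sigma> a \<noteq> a" if a: "a \<in> M" "a \<notin> L" for a
  proof -
    obtain G b where G: "partial_field_hom G" "Id_on L \<subseteq> G" "(a, b) \<in> G" "b \<noteq> a"
      "\<And>c. algebraic_elem L c \<Longrightarrow> c \<in> Domain G"
      using obtain_hom_moving[OF L alg[OF a(1)] a(2)] by blast
    interpret G: partial_field_hom G
      by (rule G(1))
    have dom: "M \<subseteq> Domain G"
      using G(5) alg by blast
    define \<sigma> where "\<sigma> = (\<lambda>c. THE d. (c, d) \<in> G)"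
    have \<sigma>_eq: "\<sigma> c = d" if "(c, d) \<in> G" for c d
      unfolding \<sigma>_def using that G.unique by blast
    have \<sigma>: "(c, \<sigma> c) \<in> G" if "c \<in> M" for c
      using that dom \<sigma>_eq by blast
    have \<sigma>M: "\<sigma> c \<in> M" if "c \<in> M" for c
      using stable[OF G(1,2) dom \<sigma>[OF that] that] .
    have \<sigma>L: "\<sigma> c = c" if "c \<in> L" for c
      using that G(2) by (intro \<sigma>_eq) blast
    have inj: "inj_on \<sigma> M"
      by (intro inj_onI) (metis \<sigma> G.injective)
    have "c \<in> \<sigma> ` M" if c: "c \<in> M" for c
    proof -
      obtain p where p: "p \<noteq> 0" "\<And>i. coeff p i \<in> L" "poly p c = 0"
        using alg[OF c] unfolding algebraic_elem_def by blast
      define Z where "Z = {z \<in> M. poly p z = 0}"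
      have "finite Z"
        using poly_roots_finite[OF p(1)] by (simp add: Z_def)
      have "\<sigma> ` Z \<subseteq> Z"
      proof
        fix y assume "y \<in> \<sigma> ` Z"
        then obtain z where z: "z \<in> M" "poly p z = 0" "y = \<sigma> z"
          by (auto simp: Z_def)
        have "G.poly_rel p p"
          unfolding G.poly_rel_def using p(2) G(2) by blast
        hence "(poly p z, poly p y) \<in> G"
          using G.poly_rel_eval \<sigma>[OF z(1)] z(3) by blast
        thus "y \<in> Z"
          using G.zero_right z \<sigma>M by (simp add: Z_def)
      qed
      hence "\<sigma> ` Z = Z"
        using \<open>finite Z\<close> inj by (intro endo_inj_surj) (auto simp: Z_def inj_on_def)
      thus ?thesis
        using c p(3) by (auto simp: Z_def)
    qed
    hence "bij_betw \<sigma> M M"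
      using inj \<sigma>M by (auto simp: bij_betw_def)
    moreover have "\<sigma> (c * d) = \<sigma> c * \<sigma> d" "\<sigma> (c + d) = \<sigma> c + \<sigma> d" if "c \<in> M" "d \<in> M" for c d
      using G.mult G.add \<sigma> that by (intro \<sigma>_eq; blast)+
    moreover have "\<sigma> 1 = 1"
      by (rule \<sigma>_eq[OF G.one])
    ultimately have "\<sigma> \<in> type_field.field_auts M L"
      using \<sigma>M \<sigma>L by (auto simp: type_field.field_auts_def ring_iso_def ring_hom_def)
    thus ?thesis
      using \<sigma>_eq[OF G(3)] G(4) by blast
  qed
  thus "{a \<in> M. \<forall>\<sigma>\<in>type_field.field_auts M L. \<sigma> a = a} = L"
    using \<open>L \<subseteq> M\<close> by (auto simp: type_field.field_auts_def)
qed

section \<open>The orbit of the walk\<close>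

text \<open>Through this instance \<open>\<KK>\<close> has characteristic zero, as the Galois
  criterion requires.\<close>

instance fract :: ("{idom, ring_char_0}") field_char_0
proof
  show "inj (of_nat :: nat \<Rightarrow> 'a fract)"
    by (intro injI) (simp add: of_nat_fract eq_fract)
qed

section \<open>Complex constants and Laurent polynomials over them\<close>

lemma cst_0 [simp]: "cst 0 = 0" and cst_1 [simp]: "cst 1 = 1"
  by (simp_all add: cst_def flip: one_pCons)

lemma cst_add: "cst (a + b) = cst a + cst b"
  by (simp add: cst_def flip: to_ac_add to_fract_add)

lemma cst_mult: "cst (a * b) = cst a * cst b"
  by (simp add: cst_def flip: to_ac_mult to_fract_mult)

lemma cst_eq_0_iff [simp]: "cst a = 0 \<longleftrightarrow> a = 0"
  by (simp add: cst_def)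

lemma cst_inverse: "cst (inverse a) = inverse (cst a)"
  using cst_mult[of a "inverse a"] by (cases "a = 0") (auto intro: inverse_unique[symmetric])

lemma cst_sum: "cst (sum f I) = (\<Sum>i\<in>I. cst (f i))"
  by (induction I rule: infinite_finite_induct) (simp_all add: cst_add)

lemma cst_power: "cst (a ^ n) = cst a ^ n"
  by (induction n) (simp_all add: cst_mult)

lemma cst_power_int: "cst (a powi n) = cst a powi n"
  by (simp add: power_int_def cst_power cst_inverse)

lemma map_poly_cst_mult: "map_poly cst (p * q) = map_poly cst p * map_poly cst q"
  by (rule poly_eqI) (simp add: coeff_map_poly coeff_mult cst_sum cst_mult)

text \<open>A complex polynomial splits into linear factors over the complex numbers, and none of
  them vanishes at a nonconstant \<open>u\<close>. So every nonconstant element of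
  \<open>\<KK>\<close> is transcendental over the constants.\<close>

lemma poly_map_cst_nonzero:
  assumes "u \<notin> range cst" "p \<noteq> 0"
  shows "poly (map_poly cst p) u \<noteq> 0"
  using assms(2)
proof (induction "Polynomial.degree p" arbitrary: p rule: less_induct)
  case less
  show ?case
  proof (cases "Polynomial.degree p = 0")
    case True
    then obtain c where "p = [:c:]"
      by (rule degree_eq_zeroE)
    thus ?thesis
      using less.prems by (simp add: map_poly_pCons)
  next
    case False
    then obtain r where "poly p r = 0"
      using alg_closed_imp_poly_has_root by blast
    then obtain q where q: "p = [:- r, 1:] * q"
      unfolding poly_eq_0_iff_dvd by (elim dvdE)
    have "q \<noteq> 0"
      using q less.prems by auto
    hence "Polynomial.degree p = Suc (Polynomial.degree q)"
      unfolding q by (subst degree_mult_eq) simp_all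
    hence "poly (map_poly cst q) u \<noteq> 0"
      using less.hyps[OF _ \<open>q \<noteq> 0\<close>] by simp
    moreover have "cst (- r) + u \<noteq> 0"
    proof
      assume "cst (- r) + u = 0"
      hence "u = cst r"
        using cst_add[of r "- r"] by (simp add: add_eq_0_iff)
      thus False
        using assms(1) by blast
    qed
    moreover have "poly (map_poly cst p) u = (cst (- r) + u) * poly (map_poly cst q) u"
      unfolding q map_poly_cst_mult by (simp add: map_poly_pCons algebra_simps)
    ultimately show ?thesis
      by (simp only: mult_eq_0_iff) simp
  qed
qed

text \<open>\<open>N\<close> is the exponent of a power that clears the negative exponents of a
  Laurent polynomial.\<close>

lemma obtain_shift:
  fixes f :: "'a \<Rightarrow> int"
  assumes "finite S"
  obtains N where "0 \<le> N" "\<And>s. s \<in> S \<Longrightarrow> 0 \<le> N + f s"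
proof
  show "0 \<le> (\<Sum>s\<in>S. \<bar>f s\<bar>)"
    by (simp add: sum_nonneg)
  show "0 \<le> (\<Sum>s\<in>S. \<bar>f s\<bar>) + f s" if "s \<in> S" for s
    using member_le_sum[of s S "\<lambda>s. \<bar>f s\<bar>"] assms that by force
qed

text \<open>At \<open>u = 0\<close> this fails: for \<open>N = 1\<close> and \<open>i = -1\<close>
  the left side is 0 and the right side is 1.\<close>

lemma power_int_shift:
  fixes u :: "'a::field"
  assumes "u \<noteq> 0" "0 \<le> N" "0 \<le> N + i"
  shows "u ^ nat N * u powi i = u ^ nat (N + i)"
  using assms power_int_add[of u N i] by (simp add: power_int_def split: if_splits)

text \<open>Multiplication by a power of \<open>u\<close> turns the sum into the value at
  \<open>u\<close> of a complex polynomial, which must be 0 because \<open>u\<close> is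
  transcendental. Distinct exponents stay distinct under the shift, so each \<open>c i\<close> is
  one of its coefficients.\<close>

lemma laurent_coeffs_zero:
  assumes "u \<notin> range cst" "finite J" "(\<Sum>j\<in>J. cst (c j) * u powi j) = 0" "i \<in> J"
  shows "c i = 0"
proof -
  have "u \<noteq> 0"
    using assms(1) cst_0 by (metis rangeI)
  obtain N where N: "0 \<le> N" "\<And>j. j \<in> J \<Longrightarrow> 0 \<le> N + j"
    using obtain_shift[OF assms(2), of "\<lambda>j. j"] by blast
  define p where "p = (\<Sum>j\<in>J. monom (c j) (nat (N + j)))"
  have "map_poly cst p = (\<Sum>j\<in>J. monom (cst (c j)) (nat (N + j)))"
    by (rule poly_eqI) (simp add: p_def coeff_map_poly coeff_sum cst_sum, rule sum.cong, auto)
  hence "poly (map_poly cst p) u = (\<Sum>j\<in>J. cst (c j) * u ^ nat (N + j))"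
    by (simp add: poly_sum poly_monom)
  also have "\<dots> = u ^ nat N * (\<Sum>j\<in>J. cst (c j) * u powi j)"
    using power_int_shift[OF \<open>u \<noteq> 0\<close> N(1) N(2)] by (simp add: sum_distrib_left mult_ac)
  finally have "p = 0"
    using poly_map_cst_nonzero[OF assms(1)] assms(3) by auto
  hence "0 = coeff p (nat (N + i))"
    by simp
  also have "\<dots> = (\<Sum>j\<in>J. if j = i then c j else 0)"
    unfolding p_def coeff_sum using N(2) assms(4)
    by (intro sum.cong) (auto simp: eq_nat_nat_iff)
  finally show ?thesis
    using assms(2,4) by simp
qed

lemma x_var_nonzero: "x_var \<noteq> 0" and y_var_nonzero: "y_var \<noteq> 0"
  by (simp_all add: x_var_def y_var_def)

lemma to_ac_monom_monom: "to_ac (to_fract (monom (monom c i) j)) = cst c * x_var ^ i * y_var ^ j"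
proof -
  have hom_power: "to_ac (to_fract (p ^ n)) = to_ac (to_fract p) ^ n"
    for p :: "complex poly poly" and n
    by (induction n) simp_all
  have "monom (monom c i) j = [:[:c:]:] * [:[:0, 1:]:] ^ i * [:0, 1:] ^ j"
    by (simp add: monom_altdef mult.commute poly_const_pow)
  thus ?thesis
    by (simp only: cst_def x_var_def y_var_def hom_power to_fract_mult to_ac_mult)
qed

text \<open>A constant value would give, after multiplication by a monomial, an identity in C[x][y].
  At the shifted position of \<open>s\<close> one side has the coefficient \<open>w s\<close> and
  the other has 0, because \<open>s\<close> is not the origin.\<close>

lemma step_poly_not_constant:
  assumes "finite \<S>" "s \<in> \<S>" "s \<noteq> (0, 0)" "w s \<noteq> 0"
  shows "step_poly \<S> w (x_var, y_var) \<notin> range cst"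
proof
  assume "step_poly \<S> w (x_var, y_var) \<in> range cst"
  then obtain c where c: "step_poly \<S> w (x_var, y_var) = cst c"
    by blast
  obtain A where A: "0 \<le> A" "\<And>s. s \<in> \<S> \<Longrightarrow> 0 \<le> A + fst s"
    using obtain_shift[OF assms(1), of fst] by blast
  obtain B where B: "0 \<le> B" "\<And>s. s \<in> \<S> \<Longrightarrow> 0 \<le> B + snd s"
    using obtain_shift[OF assms(1), of snd] by blast
  define P where "P = (\<Sum>s\<in>\<S>. monom (monom (w s) (nat (A + fst s))) (nat (B + snd s)))"
  have "to_ac (to_fract P) =
      (\<Sum>s\<in>\<S>. cst (w s) * x_var ^ nat (A + fst s) * y_var ^ nat (B + snd s))"
  proof -
    have "to_ac (to_fract (sum f \<S>)) = (\<Sum>s\<in>\<S>. to_ac (to_fract (f s)))"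
      for f :: "int \<times> int \<Rightarrow> complex poly poly"
      using assms(1) by induction simp_all
    thus ?thesis
      by (simp add: P_def to_ac_monom_monom)
  qed
  also have "\<dots> = x_var ^ nat A * y_var ^ nat B * step_poly \<S> w (x_var, y_var)"
    by (simp add: step_poly_def sum_distrib_left mult_ac A B
        power_int_shift[OF x_var_nonzero, symmetric] power_int_shift[OF y_var_nonzero, symmetric])
  also have "\<dots> = to_ac (to_fract (monom (monom c (nat A)) (nat B)))"
    by (simp add: c to_ac_monom_monom mult_ac)
  finally have "P = monom (monom c (nat A)) (nat B)"
    by simp
  moreover have "coeff (coeff P (nat (B + snd s))) (nat (A + fst s)) =
      (\<Sum>r\<in>\<S>. if r = s then w r else 0)"
    unfolding P_def coeff_sum using A B assms(2)
    by (intro sum.cong) (auto simp: eq_nat_nat_iff prod_eq_iff)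
  moreover have "coeff (coeff (monom (monom c (nat A)) (nat B)) (nat (B + snd s))) (nat (A + fst s)) = 0"
    using A B assms(2,3) by (auto simp: eq_nat_nat_iff prod_eq_iff)
  ultimately show False
    using assms(1,2,4) by simp
qed

section \<open>Each coordinate of a pair is algebraic over the other and t\<close>

text \<open>If \<open>S(u,Y) - t\<close> vanished identically, then \<open>u\<close> would be a constant because some coefficient
  of a nonzero power of \<open>Y\<close> vanishes at \<open>u\<close>, and then \<open>t\<close>, the coefficient of \<open>Y\<^sup>0\<close> in \<open>S(u,Y)\<close>,
  would be a constant as well. The case \<open>v = 0\<close> is separate because of \<open>0 powi n = 0\<close>.\<close>

lemma second_coordinate_mem:
  assumes A: "subfield A \<KK>" and closed: "\<And>b. algebraic_elem A b \<Longrightarrow> b \<in> A"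
    and cstA: "range cst \<subseteq> A" and t: "step_poly \<S> w (u, v) \<in> A" "step_poly \<S> w (u, v) \<notin> range cst"
    and \<S>: "finite \<S>" "s \<in> \<S>" "snd s \<noteq> 0" "w s \<noteq> 0" and u: "u \<in> A"
  shows "v \<in> A"
proof (cases "v = 0")
  case True
  thus ?thesis
    using subfield_0[OF A] by simp
next
  case False
  define t where "t = step_poly \<S> w (u, v)"
  obtain N where N: "0 \<le> N" "\<And>s. s \<in> \<S> \<Longrightarrow> 0 \<le> N + snd s"
    using obtain_shift[OF \<S>(1), of snd] by blast
  \<comment> \<open>\<open>Q\<close> is S(u,Y) - t multiplied by the \<open>N\<close>-th power of
    Y.\<close>
  define Q where "Q = (\<Sum>s\<in>\<S>. monom (cst (w s) * u powi fst s) (nat (N + snd s))) - monom t (nat N)"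
  have "poly Q v = (\<Sum>s\<in>\<S>. cst (w s) * u powi fst s * v ^ nat (N + snd s)) - t * v ^ nat N"
    by (simp add: Q_def poly_sum poly_monom)
  also have "\<dots> = v ^ nat N * step_poly \<S> w (u, v) - t * v ^ nat N"
    by (simp add: step_poly_def sum_distrib_left mult_ac N power_int_shift[OF False, symmetric])
  finally have root: "poly Q v = 0"
    by (simp add: t_def)
  have coeffs: "coeff Q i \<in> A" for i
    unfolding Q_def coeff_diff coeff_sum coeff_monom
    by (intro subfield_diff[OF A] subfield_sum[OF A])
      (use cstA u t(1) in \<open>auto simp: t_def intro: subfield_0[OF A] subfield_mult[OF A] subfield_power_int[OF A]\<close>)
  have coeff_shift: "coeff Q (nat (N + j)) =
      (\<Sum>s\<in>{s\<in>\<S>. snd s = j}. cst (w s) * u powi fst s) - (if j = 0 then t else 0)"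
    if "0 \<le> N + j" for j
  proof -
    have "(\<Sum>s\<in>\<S>. coeff (monom (cst (w s) * u powi fst s) (nat (N + snd s))) (nat (N + j))) =
        (\<Sum>s\<in>\<S>. if snd s = j then cst (w s) * u powi fst s else 0)"
      using N that by (intro sum.cong) (auto simp: eq_nat_nat_iff)
    thus ?thesis
      using N(1) that \<S>(1) by (simp add: Q_def coeff_sum sum.inter_filter eq_nat_nat_iff)
  qed
  show ?thesis
  proof (cases "Q = 0")
    case False
    thus ?thesis
      using root coeffs closed unfolding algebraic_elem_def by blast
  next
    case True
    have "u \<notin> range cst"
    proof
      assume "u \<in> range cst"
      then obtain c where "u = cst c"
        by blast
      \<comment> \<open>This covers \<open>c = 0\<close> too, since \<open>cst_power_int\<close>
        respects the convention for negative powers of 0.\<close>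
      hence "t = cst (\<Sum>s\<in>{s\<in>\<S>. snd s = 0}. w s * c powi fst s)"
        using coeff_shift[of 0] N(1) True by (simp add: cst_sum cst_mult cst_power_int)
      thus False
        using t(2) by (auto simp: t_def)
    qed
    define J where "J = {r\<in>\<S>. snd r = snd s}"
    have "(\<Sum>i\<in>fst ` J. cst (w (i, snd s)) * u powi i) = (\<Sum>r\<in>J. cst (w r) * u powi fst r)"
      by (subst sum.reindex) (auto simp: J_def inj_on_def intro!: sum.cong)
    also have "\<dots> = 0"
      using coeff_shift[of "snd s"] N(2)[OF \<S>(2)] \<S>(3) True by (simp add: J_def)
    finally have "w (fst s, snd s) = 0"
      by (rule laurent_coeffs_zero[OF \<open>u \<notin> range cst\<close>, rotated]) (use \<S> in \<open>auto simp: J_def\<close>)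
    thus ?thesis
      using \<S>(4) by simp
  qed
qed

lemma step_poly_swap: "step_poly (prod.swap ` \<S>) (w \<circ> prod.swap) (v, u) = step_poly \<S> w (u, v)"
  by (simp add: step_poly_def sum.reindex mult_ac)

lemma first_coordinate_mem:
  assumes A: "subfield A \<KK>" and closed: "\<And>b. algebraic_elem A b \<Longrightarrow> b \<in> A"
    and cstA: "range cst \<subseteq> A" and t: "step_poly \<S> w (u, v) \<in> A" "step_poly \<S> w (u, v) \<notin> range cst"
    and \<S>: "finite \<S>" "s \<in> \<S>" "fst s \<noteq> 0" "w s \<noteq> 0" and v: "v \<in> A"
  shows "u \<in> A"
  using second_coordinate_mem[OF A closed cstA, of "prod.swap ` \<S>" "w \<circ> prod.swap" v u "prod.swap s"]
    t \<S> v by (simp add: step_poly_swap)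

section \<open>The orbit and the field it generates\<close>

lemma subfield_adjoin: "subfield (adjoin k A) \<KK>"
  unfolding adjoin_def by (rule field.generate_field_is_subfield[OF field_from_type_algebra]) simp

lemma subset_adjoin: "k \<subseteq> adjoin k A" "A \<subseteq> adjoin k A"
  unfolding adjoin_def by (auto intro: generate_field.incl)

lemma adjoin_minimal: "subfield E \<KK> \<Longrightarrow> k \<subseteq> E \<Longrightarrow> A \<subseteq> E \<Longrightarrow> adjoin k A \<subseteq> E"
  unfolding adjoin_def
  by (rule field.generate_field_min_subfield1[OF field_from_type_algebra]) auto

lemma range_cst_subset_base_field: "range cst \<subseteq> base_field \<S> w"
  unfolding base_field_def by (rule subset_adjoin)

lemma step_poly_mem_base_field: "step_poly \<S> w (x_var, y_var) \<in> base_field \<S> w"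
  unfolding base_field_def using subset_adjoin(2) by blast

lemma defined_at_nonzero: "u \<noteq> 0 \<Longrightarrow> v \<noteq> 0 \<Longrightarrow> defined_at \<S> (u, v)"
  by (simp add: defined_at_def)

text \<open>\<open>tranclp\<close> is not reflexive; the starting pair belongs to the orbit because
  both coordinates are nonzero, so S is defined there and the pair is adjacent to itself.\<close>

lemma xy_mem_walk_orbit: "(x_var, y_var) \<in> walk_orbit \<S> w"
  unfolding walk_orbit_def adjacent_def x_adjacent_def same_value_def
  by (auto intro!: tranclp.r_into_trancl defined_at_nonzero x_var_nonzero y_var_nonzero)

lemma base_field_subset_orbit_field: "base_field \<S> w \<subseteq> orbit_field \<S> w"
  unfolding orbit_field_def by (rule subset_adjoin)

lemma walk_orbit_mem_orbit_field:
  assumes "(u, v) \<in> walk_orbit \<S> w"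
  shows "u \<in> orbit_field \<S> w" "v \<in> orbit_field \<S> w"
proof -
  have "u \<in> fst ` walk_orbit \<S> w" "v \<in> snd ` walk_orbit \<S> w"
    using imageI[OF assms, of fst] imageI[OF assms, of snd] by simp_all
  thus "u \<in> orbit_field \<S> w" "v \<in> orbit_field \<S> w"
    unfolding orbit_field_def by (blast intro: subset_adjoin(2)[THEN subsetD])+
qed

lemma orbit_field_minimal:
  assumes "subfield E \<KK>" "base_field \<S> w \<subseteq> E"
    and "\<And>u v. (u, v) \<in> walk_orbit \<S> w \<Longrightarrow> u \<in> E \<and> v \<in> E"
  shows "orbit_field \<S> w \<subseteq> E"
  unfolding orbit_field_def using assms by (intro adjoin_minimal) auto

lemma walk_orbit_induct [consumes 1, case_names start adjacent]:
  assumes "p \<in> walk_orbit \<S> w" "P (x_var, y_var)"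
    and "\<And>p q. adjacent \<S> w p q \<Longrightarrow> q \<in> walk_orbit \<S> w \<Longrightarrow> P q \<Longrightarrow> P p"
  shows "P p"
proof -
  have "tranclp (adjacent \<S> w) p (x_var, y_var)"
    using assms(1) by (simp add: walk_orbit_def)
  thus ?thesis
  proof (induction rule: converse_tranclp_induct)
    case (base p)
    thus ?case
      using assms(2,3) xy_mem_walk_orbit by blast
  next
    case (step p q)
    thus ?case
      using assms(3)[of p q] by (simp add: walk_orbit_def)
  qed
qed

context
  fixes \<S> :: "(int \<times> int) set" and w :: "int \<times> int \<Rightarrow> complex"
  assumes finite: "finite \<S>" and weights: "\<And>s. s \<in> \<S> \<Longrightarrow> w s \<noteq> 0" and nu: "not_univariate \<S>"
begin

lemma steps: obtains r s where "r \<in> \<S>" "fst r \<noteq> 0" "w r \<noteq> 0" "s \<in> \<S>" "snd s \<noteq> 0" "w s \<noteq> 0"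
  using nu weights unfolding not_univariate_def by blast

lemma step_poly_xy_not_constant: "step_poly \<S> w (x_var, y_var) \<notin> range cst"
  by (rule steps, rule step_poly_not_constant[OF finite]) auto

lemma coordinates_mem:
  assumes A: "subfield A \<KK>" "\<And>b. algebraic_elem A b \<Longrightarrow> b \<in> A"
    and base: "base_field \<S> w \<subseteq> A"
    and eq: "step_poly \<S> w (u, v) = step_poly \<S> w (x_var, y_var)"
  shows "u \<in> A \<longleftrightarrow> v \<in> A"
proof -
  obtain r s where "r \<in> \<S>" "fst r \<noteq> 0" "w r \<noteq> 0" "s \<in> \<S>" "snd s \<noteq> 0" "w s \<noteq> 0"
    by (rule steps)
  thus ?thesis
    using first_coordinate_mem[OF A, of \<S> w u v r] second_coordinate_mem[OF A, of \<S> w u v s]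
      range_cst_subset_base_field step_poly_mem_base_field step_poly_xy_not_constant base finite
    unfolding eq by blast
qed

text \<open>A pair shares one coordinate with the neighbour already treated, and
  \<open>coordinates_mem\<close> supplies the other. The value of S is carried through the induction
  because that lemma needs it to be t.\<close>

lemma walk_orbit_mem:
  assumes A: "subfield A \<KK>" "\<And>b. algebraic_elem A b \<Longrightarrow> b \<in> A"
    and base: "base_field \<S> w \<subseteq> A" and xy: "x_var \<in> A \<or> y_var \<in> A"
    and "p \<in> walk_orbit \<S> w"
  shows "fst p \<in> A \<and> snd p \<in> A"
proof -
  have "step_poly \<S> w p = step_poly \<S> w (x_var, y_var) \<and> fst p \<in> A \<and> snd p \<in> A"
    using assms(5)
  proof (induction rule: walk_orbit_induct)
    case start
    thus ?case
      using coordinates_mem[OF A base refl] xy by auto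
  next
    case (adjacent p q)
    hence eq: "step_poly \<S> w (fst p, snd p) = step_poly \<S> w (x_var, y_var)"
      by (auto simp: adjacent_def x_adjacent_def y_adjacent_def same_value_def)
    have "fst p \<in> A \<or> snd p \<in> A"
      using adjacent by (auto simp: adjacent_def x_adjacent_def y_adjacent_def)
    thus ?case
      using coordinates_mem[OF A base eq] eq by auto
  qed
  thus ?thesis
    by blast
qed

end

section \<open>Homomorphisms acting on the orbit\<close>

context
  fixes \<S> :: "(int \<times> int) set" and w :: "int \<times> int \<Rightarrow> complex"
    and G :: "(ratfun_closure \<times> ratfun_closure) set"
  assumes hom: "partial_field_hom G" and base: "Id_on (base_field \<S> w) \<subseteq> G"
begin

interpretation partial_field_hom G
  by (rule hom)

lemma step_poly_hom:
  assumes "(u, u') \<in> G" "(v, v') \<in> G"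
  shows "(step_poly \<S> w (u, v), step_poly \<S> w (u', v')) \<in> G"
proof -
  have "(cst c, cst c) \<in> G" for c
    using base range_cst_subset_base_field by blast
  thus ?thesis
    using assms by (auto simp: step_poly_def intro!: sum mult power_int)
qed

text \<open>Definedness only concerns the vanishing of coordinates, which \<open>zero_iff\<close>
  transfers.\<close>

lemma same_value_hom:
  assumes "same_value \<S> w (u1, v1) (u2, v2)"
    and "(u1, u1') \<in> G" "(v1, v1') \<in> G" "(u2, u2') \<in> G" "(v2, v2') \<in> G"
  shows "same_value \<S> w (u1', v1') (u2', v2')"
  using assms(1) step_poly_hom[OF assms(2,3)] step_poly_hom[OF assms(4,5)] unique
    assms(2-5)[THEN zero_iff]
  by (auto simp: same_value_def defined_at_def)

lemma adjacent_hom: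
  assumes "adjacent \<S> w (u1, v1) (u2, v2)"
    and "(u1, u1') \<in> G" "(v1, v1') \<in> G" "(u2, u2') \<in> G" "(v2, v2') \<in> G"
  shows "adjacent \<S> w (u1', v1') (u2', v2')"
  using assms(1) same_value_hom[OF _ assms(2-5)] unique assms(2-5)
  by (auto simp: adjacent_def x_adjacent_def y_adjacent_def)

text \<open>\<open>dom\<close> provides images for the pairs between \<open>p\<close> and the
  starting pair; the images given for \<open>p\<close> are then adjacent to those of its
  neighbour.\<close>

lemma walk_orbit_hom:
  assumes xy: "(x_var, x_var) \<in> G \<or> (y_var, y_var) \<in> G"
    and dom: "orbit_field \<S> w \<subseteq> Domain G"
    and "p \<in> walk_orbit \<S> w" "(fst p, u) \<in> G" "(snd p, v) \<in> G"
  shows "(u, v) \<in> walk_orbit \<S> w"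
  using assms(3-5)
proof (induction arbitrary: u v rule: walk_orbit_induct)
  case start
  hence G: "(x_var, u) \<in> G" "(y_var, v) \<in> G"
    by simp_all
  let ?t = "step_poly \<S> w (x_var, y_var)"
  have "(?t, ?t) \<in> G"
    using base step_poly_mem_base_field by blast
  hence "step_poly \<S> w (u, v) = ?t"
    using step_poly_hom[OF G] unique by blast
  moreover have "u \<noteq> 0" "v \<noteq> 0"
    using G[THEN zero_iff] x_var_nonzero y_var_nonzero by simp_all
  moreover have "u = x_var \<or> v = y_var"
    using xy G unique by blast
  ultimately have "adjacent \<S> w (u, v) (x_var, y_var)"
    by (auto simp: adjacent_def x_adjacent_def y_adjacent_def same_value_def
        intro!: defined_at_nonzero x_var_nonzero y_var_nonzero)
  thus ?case
    by (auto simp: walk_orbit_def)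
next
  case (adjacent p q)
  have "fst q \<in> orbit_field \<S> w" "snd q \<in> orbit_field \<S> w"
    using walk_orbit_mem_orbit_field[of "fst q" "snd q"] adjacent.hyps(2) by simp_all
  then obtain u' v' where q: "(fst q, u') \<in> G" "(snd q, v') \<in> G"
    using dom by blast
  hence "(u', v') \<in> walk_orbit \<S> w"
    by (rule adjacent.IH)
  moreover have "adjacent \<S> w (u, v) (u', v')"
    using adjacent_hom[of "fst p" "snd p" "fst q" "snd q" u v u' v'] adjacent.hyps(1) adjacent.prems q
    by simp
  ultimately show ?case
    by (auto simp: walk_orbit_def intro: tranclp_into_tranclp2)
qed

lemma orbit_field_hom:
  assumes xy: "(x_var, x_var) \<in> G \<or> (y_var, y_var) \<in> G"
    and dom: "orbit_field \<S> w \<subseteq> Domain G"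
    and "a \<in> orbit_field \<S> w" "(a, b) \<in> G"
  shows "b \<in> orbit_field \<S> w"
proof -
  define M where "M = orbit_field \<S> w"
  have M: "subfield M \<KK>"
    unfolding M_def orbit_field_def by (rule subfield_adjoin)
  \<comment> \<open>The preimage of k(O) under the homomorphism. It is a subfield, so it contains
    k(O) as soon as it contains the generators.\<close>
  define E where "E = {a. \<exists>b\<in>M. (a, b) \<in> G}"
  have "subfield E \<KK>"
  proof (rule subfield_from_type_algebraI)
    show "1 \<in> E"
      using one subfield_1[OF M] by (auto simp: E_def)
    fix a b assume "a \<in> E" "b \<in> E"
    then obtain a' b' where *: "(a, a') \<in> G" "a' \<in> M" "(b, b') \<in> G" "b' \<in> M"
      unfolding E_def by blast
    show "a + b \<in> E"
      unfolding E_def using add[OF *(1,3)] subfield_add[OF M *(2,4)] by blast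
    show "a * b \<in> E"
      unfolding E_def using mult[OF *(1,3)] subfield_mult[OF M *(2,4)] by blast
  next
    fix a assume "a \<in> E"
    then obtain a' where *: "(a, a') \<in> G" "a' \<in> M"
      unfolding E_def by blast
    show "- a \<in> E"
      unfolding E_def using uminus[OF *(1)] subfield_uminus[OF M *(2)] by blast
    show "inverse a \<in> E"
      unfolding E_def using inverse[OF *(1)] subfield_inverse[OF M *(2)] by blast
  qed
  moreover have "base_field \<S> w \<subseteq> E"
    using base base_field_subset_orbit_field unfolding E_def M_def by fast
  moreover have "u \<in> E \<and> v \<in> E" if uv: "(u, v) \<in> walk_orbit \<S> w" for u v
  proof -
    obtain u' v' where "(u, u') \<in> G" "(v, v') \<in> G"
      using walk_orbit_mem_orbit_field[OF uv] dom by blast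
    thus ?thesis
      using walk_orbit_hom[OF xy dom uv, of u' v'] walk_orbit_mem_orbit_field[of u' v']
      by (auto simp: E_def M_def)
  qed
  ultimately have "orbit_field \<S> w \<subseteq> E"
    by (rule orbit_field_minimal)
  then obtain b' where "(a, b') \<in> G" "b' \<in> M"
    using assms(3) by (auto simp: E_def)
  thus ?thesis
    using unique assms(4) by (auto simp: M_def)
qed

end

text \<open>The variable \<open>z\<close> treats both extensions at once: fixing either coordinate
  of the starting pair makes its image adjacent to it.\<close>

theorem orbit_field_galois:
  assumes \<S>: "finite \<S>" "\<And>s. s \<in> \<S> \<Longrightarrow> w s \<noteq> 0" "not_univariate \<S>"
    and z: "z = x_var \<or> z = y_var"
  shows "ring.galois_extension \<KK> (orbit_field \<S> w) (adjoin (base_field \<S> w) {z})"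
proof (rule galois_extension_if_stable)
  define L where "L = adjoin (base_field \<S> w) {z}"
  have L: "subfield L \<KK>" "base_field \<S> w \<subseteq> L" "z \<in> L"
    using subset_adjoin[where k = "base_field \<S> w" and A = "{z}"]
    by (auto simp: L_def subfield_adjoin)
  define A where "A = {a. algebraic_elem L a}"
  have A: "subfield A \<KK>" "\<And>b. algebraic_elem A b \<Longrightarrow> b \<in> A"
    unfolding A_def using subfield_algebraic_elems[OF L(1)] algebraic_elem_trans[OF L(1)] by auto
  have "L \<subseteq> A"
    using algebraic_elem_self[OF L(1)] by (auto simp: A_def)
  hence base: "base_field \<S> w \<subseteq> A" and xy: "x_var \<in> A \<or> y_var \<in> A"
    using L(2,3) z by auto
  show "subfield (orbit_field \<S> w) \<KK>"
    unfolding orbit_field_def by (rule subfield_adjoin)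
  show "subfield (adjoin (base_field \<S> w) {z}) \<KK>"
    by (rule subfield_adjoin)
  show "adjoin (base_field \<S> w) {z} \<subseteq> orbit_field \<S> w"
    using z walk_orbit_mem_orbit_field[OF xy_mem_walk_orbit] base_field_subset_orbit_field
    by (intro adjoin_minimal) (auto simp: orbit_field_def subfield_adjoin)
  have "orbit_field \<S> w \<subseteq> A"
    by (rule orbit_field_minimal[OF A(1) base])
      (use walk_orbit_mem[OF \<S> A base xy] in force)
  thus "algebraic_elem (adjoin (base_field \<S> w) {z}) a" if "a \<in> orbit_field \<S> w" for a
    using that by (auto simp: A_def L_def)
  fix G a b
  assume G: "partial_field_hom G" "Id_on (adjoin (base_field \<S> w) {z}) \<subseteq> G"
    "orbit_field \<S> w \<subseteq> Domain G" "(a, b) \<in> G" "a \<in> orbit_field \<S> w"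
  have "Id_on (base_field \<S> w) \<subseteq> G" "(x_var, x_var) \<in> G \<or> (y_var, y_var) \<in> G"
    using G(2) L(2,3) z by (auto simp: L_def)
  thus "b \<in> orbit_field \<S> w"
    using orbit_field_hom[OF G(1) _ _ G(3,5,4)] by blast
qed

theorem theorem11:
  fixes \<S> :: "(int \<times> int) set" and w :: "int \<times> int \<Rightarrow> complex"
  assumes "finite \<S>"
    and "\<And>s. s \<in> \<S> \<Longrightarrow> w s \<noteq> 0"
    and "not_univariate \<S>"
  shows "ring.galois_extension \<KK> (orbit_field \<S> w) (adjoin (base_field \<S> w) {x_var})
       \<and> ring.galois_extension \<KK> (orbit_field \<S> w) (adjoin (base_field \<S> w) {y_var})"
  using orbit_field_galois[OF assms(1) _ assms(3)] assms(2) by blast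

end
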